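(* Let $M > 1$ be a natural number. Then either $M$ is itself a biprime, or $M$ can be uniquely represented as a tower-like exponentiation $$M = a_n\uparrow(a_{n-1}\uparrow(\cdots(a_2\uparrow a_1)\cdots)),$$ where $a_i \neq 1$ ($i=1,\ldots,n$) are biprimes; that is, there exists exactly one finite sequence $(a_1,\ldots,a_n)$ of biprimes (both the length $n$ and the ordered terms being uniquely determined by $M$) for which this equality holds.
   Context: $\mathbb{N}$ denotes the set of natural numbers $\{1,2,3,\ldots\}$ (without $0$). The symbol $\uparrow$ denotes exponentiation, $a\uparrow b = a^b$, and towers are evaluated from right to left, as indicated by the parentheses. A natural number $M>1$ is called bi-compound (2-decomposable) if there exist $a, x\in\mathbb{N}$ with $a>1$, $x>1$ and $a^x = M$. A natural number $M>1$ that is not bi-compound is called biprime (2-prime). *)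

theory Defs
  imports Main
begin

definition bi_compound :: "nat \<Rightarrow> bool" where
  "bi_compound M \<longleftrightarrow> M > 1 \<and> (\<exists>a x. a > 1 \<and> x > 1 \<and> a ^ x = M)"

definition biprime :: "nat \<Rightarrow> bool" where
  "biprime M \<longleftrightarrow> M > 1 \<and> \<not> bi_compound M"

(* The list is in the order [a_1, ..., a_n], so the head is the topmost exponent
   and the last element is the bottom base: the value is a_n ^ (... ^ (a_2 ^ a_1)).
   Starting from 1 makes the first step a_1 ^ 1 = a_1; the empty tower is 1. *)
definition tower :: "nat list \<Rightarrow> nat" where
  "tower as = foldl (\<lambda>t a. a ^ t) 1 as"

end

theory Submission imports Defs begin

text \<open>
  If a power of \<open>a\<close> equals a power of \<open>b\<close>, then by Euclid's algorithm on the exponents \<open>a\<close> and \<open>b\<close>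
  are powers of a common number, so two biprimes with a common power coincide. Hence every
  \<open>M > 1\<close> is \<open>a ^ x\<close> for exactly one biprime \<open>a\<close> and one \<open>x\<close>, and one recurses into \<open>x < M\<close>, down to
  the exponent \<open>1\<close>, which is the empty tower.
\<close>

lemma power_eq_power_imp_common_base:
  fixes a b :: nat
  assumes "a ^ x = b ^ y" "a > 0" "b > 0" "x > 0" "y > 0"
  shows "\<exists>d i j. a = d ^ i \<and> b = d ^ j"
  using assms
proof (induction "x + y" arbitrary: a b x y rule: less_induct)
  case less
  \<comment> \<open>One subtraction step of Euclid: \<open>v\<close> divides \<open>u\<close>, and
    the quotient \<open>c\<close> satisfies \<open>c ^ s = v ^ (t - s)\<close>, so the exponent sum
    drops from \<open>s + t\<close> to \<open>t\<close>. Fresh variables let it serve both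
    \<open>x < y\<close> and \<open>y < x\<close>.\<close>
  have descent: "\<exists>d i j. u = d ^ i \<and> v = d ^ j"
    if eq: "u ^ s = v ^ t" and pos: "u > 0" "v > 0" "s > 0" and "s < t" and sum: "s + t = x + y"
    for u v s t :: nat
  proof -
    have "u ^ s = v ^ s * v ^ (t - s)"
      using eq \<open>s < t\<close> by (simp flip: power_add)
    then have "v ^ s dvd u ^ s" by simp
    then have "v dvd u" using \<open>s > 0\<close> by simp
    then obtain c where c: "u = v * c" by blast
    have "c ^ s = v ^ (t - s)"
      using \<open>u ^ s = v ^ s * v ^ (t - s)\<close> \<open>v > 0\<close> by (simp add: c power_mult_distrib)
    moreover have "c > 0" using c \<open>u > 0\<close> by simp
    moreover have "s + (t - s) < x + y" using pos \<open>s < t\<close> sum by linarith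
    ultimately obtain d i j where "c = d ^ i" "v = d ^ j"
      using less.hyps[of s "t - s" c v] pos \<open>s < t\<close> by (metis zero_less_diff)
    then have "u = d ^ (j + i)" using c by (simp add: power_add)
    with \<open>v = d ^ j\<close> show ?thesis by blast
  qed
  consider "x = y" | "x < y" | "y < x" by linarith
  then show ?case
  proof cases
    case 1
    then have "a = b" using less.prems power_eq_iff_eq_base[of x a b] by simp
    then show ?thesis by (metis power_one_right)
  next
    case 2
    then show ?thesis using descent[of a x b y] less.prems by simp
  next
    case 3
    then show ?thesis using descent[of b y a x] less.prems by (simp add: add.commute) blast
  qed
qed

text \<open>Exponent 0 would give 1, and an exponent above 1 would make the power bi-compound. Two
  biprimes that are powers of the same \<open>d\<close> therefore both equal
  \<open>d\<close>.\<close>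

lemma biprime_power_imp_eq_base:
  assumes "biprime (d ^ i)"
  shows "d ^ i = d"
proof -
  have gt: "d ^ i > 1" and nc: "\<not> bi_compound (d ^ i)"
    using assms by (auto simp: biprime_def)
  have "i \<noteq> 0" using gt by (intro notI) simp
  moreover have "d > 1"
  proof (rule ccontr)
    assume "\<not> d > 1"
    then have "d = 0 \<or> d = 1" by linarith
    then show False using gt \<open>i \<noteq> 0\<close> by (auto simp: power_0_left)
  qed
  ultimately have "i = 1" using nc gt unfolding bi_compound_def by (metis less_one linorder_neqE_nat)
  then show ?thesis by simp
qed

lemma biprime_power_eq_power_iff:
  assumes "biprime a" "biprime b" "x > 0" "y > 0"
  shows "a ^ x = b ^ y \<longleftrightarrow> a = b \<and> x = y"
proof
  assume eq: "a ^ x = b ^ y"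
  have "a > 1" "b > 1" using assms by (auto simp: biprime_def)
  then obtain d i j where "a = d ^ i" "b = d ^ j"
    using power_eq_power_imp_common_base[OF eq] assms by auto
  then have "a = b" using assms biprime_power_imp_eq_base by metis
  then show "a = b \<and> x = y" using eq \<open>b > 1\<close> by simp
qed simp

text \<open>The least \<open>a > 1\<close> with \<open>M\<close> among its powers is biprime: if
  \<open>a = b ^ y\<close> with \<open>y > 1\<close>, then \<open>M\<close> is also a power of the
  smaller \<open>b\<close>.\<close>

lemma biprime_power_exists:
  assumes "M > 1"
  obtains a x where "biprime a" "x > 0" "M = a ^ x"
proof -
  define P where "P a \<longleftrightarrow> a > 1 \<and> (\<exists>x. M = a ^ x)" for a
  define a where "a = (LEAST a. P a)"
  have "P M" unfolding P_def using assms by (metis power_one_right)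
  then have "P a" unfolding a_def by (rule LeastI)
  then obtain x where a: "a > 1" and x: "M = a ^ x" by (auto simp: P_def)
  have "\<not> bi_compound a"
  proof
    assume "bi_compound a"
    then obtain b y where b: "b > 1" "y > 1" "a = b ^ y" by (auto simp: bi_compound_def)
    then have "P b" using x by (auto simp: P_def simp flip: power_mult)
    then have "a \<le> b" unfolding a_def by (rule Least_le)
    moreover have "b ^ 1 < b ^ y" using b by (intro power_strict_increasing)
    ultimately show False using b by simp
  qed
  moreover have "x > 0" using x assms by (cases x) auto
  ultimately show ?thesis using that a x by (auto simp: biprime_def)
qed

lemma tower_Nil [simp]: "tower [] = 1"
  by (simp add: tower_def)

lemma tower_snoc [simp]: "tower (as @ [a]) = a ^ tower as"
  by (simp add: tower_def)

lemma tower_pos: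
  assumes "\<forall>a\<in>set as. biprime a"
  shows "tower as > 0"
  using assms by (induction as rule: rev_induct) (auto simp: biprime_def)

text \<open>Separates nonempty towers from the empty one, whose value is 1; this is what makes the
  length unique.\<close>

lemma tower_snoc_gt_1:
  assumes "\<forall>c\<in>set (as @ [a]). biprime c"
  shows "tower (as @ [a]) > 1"
  using assms tower_pos[of as] one_less_power[of a "tower as"] by (simp add: biprime_def)

text \<open>\<open>M = 1\<close> is included because the recursion into the exponent ends there, at
  the empty tower.\<close>

lemma tower_biprimes_exists:
  assumes "M > 0"
  shows "\<exists>as. (\<forall>a\<in>set as. biprime a) \<and> M = tower as"
  using assms
proof (induction M rule: less_induct)
  case (less M)
  show ?case
  proof (cases "M = 1")
    case True
    then show ?thesis by (intro exI[of _ "[]"]) simp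
  next
    case False
    with less.prems have "M > 1" by simp
    then obtain a x where a: "biprime a" and x: "x > 0" "M = a ^ x"
      by (rule biprime_power_exists)
    have "x < M" using a x by (simp add: biprime_def power_gt_expt)
    then obtain as where "\<forall>a\<in>set as. biprime a" "x = tower as"
      using less.IH x by blast
    then show ?thesis using a x by (intro exI[of _ "as @ [a]"]) simp
  qed
qed

lemma tower_biprimes_inj:
  assumes "\<forall>a\<in>set as. biprime a" "\<forall>b\<in>set bs. biprime b" "tower as = tower bs"
  shows "as = bs"
  using assms
\<comment> \<open>The bottom base is the last entry, so lists are peeled from the right.\<close>
proof (induction as arbitrary: bs rule: rev_induct)
  case Nil
  then show ?case
    using tower_snoc_gt_1 by (cases bs rule: rev_cases) fastforce+
next
  case (snoc a as)
  show ?case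
  proof (cases bs rule: rev_cases)
    case Nil
    then show ?thesis using snoc.prems tower_snoc_gt_1[of as a] by (simp del: tower_snoc)
  next
    case (snoc bs' b)
    with snoc.prems have "a = b \<and> tower as = tower bs'"
      using biprime_power_eq_power_iff[of a b] tower_pos[of as] tower_pos[of bs'] by simp
    then show ?thesis using snoc.IH[of bs'] snoc.prems snoc by simp
  qed
qed

theorem theorem1:
  fixes M :: nat
  assumes "M > 1"
  shows "biprime M \<or>
    (\<exists>!as. as \<noteq> [] \<and> (\<forall>a \<in> set as. a \<noteq> 1 \<and> biprime a) \<and> M = tower as)"
proof (rule disjI2)
  \<comment> \<open>The second alternative holds for every \<open>M > 1\<close>: a biprime
    \<open>M\<close> is the one-entry tower \<open>[M]\<close>.\<close>
  obtain as where as: "\<forall>a\<in>set as. biprime a" "M = tower as"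
    using tower_biprimes_exists[of M] assms by auto
  moreover have "as \<noteq> []" using as assms by auto
  moreover have "\<forall>a\<in>set as. a \<noteq> 1" using as by (auto simp: biprime_def)
  ultimately show "\<exists>!as. as \<noteq> [] \<and> (\<forall>a \<in> set as. a \<noteq> 1 \<and> biprime a) \<and> M = tower as"
    using tower_biprimes_inj by (intro ex1I[of _ as]) auto
qed

end
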